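(* Let $D^-$ be the additive code defined in the context and let $D^{3-}$ be any code of length $9$ obtained from $D^-$ by puncturing (deleting) any two of its coordinates. Then the trace dual $(D^{3-})^\perp$ has weight distribution $[\langle 0,1\rangle,\langle 6,36\rangle,\langle 8,27\rangle]$, i.e. it contains $1$ word of weight $0$, $36$ of weight $6$, $27$ of weight $8$ and no others.
   Context: $\mathbb{F}_4=\{0,1,\omega,\omega^2\}$ with $\omega^2=\omega+1$; $\mathrm{Tr}(z)=z+z^2$. The dual of an additive code $C\subseteq\mathbb{F}_4^n$ is $C^\perp=\{y: \sum_i\mathrm{Tr}(x_iy_i^2)=0\ \forall x\in C\}$. Puncturing at a coordinate means projecting onto the remaining coordinates. $D^-$ is the $\mathbb{F}_2$-span of the following $12$ vectors of $\mathbb{F}_4^{11}$: $(0,0,0,0,0,\omega^2,\omega^2,0,\omega,1,\omega)$, $(0,0,0,0,0,\omega,0,\omega,\omega,\omega,1)$, $(1,0,0,0,0,1,0,1,\omega^2,\omega^2,1)$, $(\omega,0,0,0,0,0,\omega,1,\omega,\omega,\omega)$, $(0,1,0,0,0,0,1,1,1,\omega^2,\omega^2)$, $(0,\omega,0,0,0,\omega^2,1,\omega^2,\omega,\omega,0)$, $(0,0,1,0,0,\omega,\omega,1,1,0,1)$, $(0,0,\omega,0,0,\omega,1,\omega,\omega^2,\omega^2,0)$, $(0,0,0,1,0,\omega,\omega,\omega,0,1,\omega)$, $(0,0,0,\omega,0,\omega^2,1,1,\omega^2,0,\omega)$, $(0,0,0,0,1,\omega^2,\omega^2,\omega^2,1,0,\omega^2)$,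 $(0,0,0,0,\omega,\omega,1,0,1,\omega,\omega)$. *)

theory Defs
  imports Main "HOL-Library.Z2"
begin

text \<open>
  The field with four elements: \<open>GF4 a b\<close> stands for $a + b\omega$ with $a, b \in \mathbb{F}_2$,
  and multiplication is the one forced by $\omega^2 = \omega + 1$. Inversion is squaring,
  since $x^3 = 1$ for $x \neq 0$.
\<close>

datatype gf4 = GF4 bit bit

lemma gf4_exhaust: "x = GF4 0 0 \<or> x = GF4 1 0 \<or> x = GF4 0 1 \<or> x = GF4 1 1"
proof (cases x)
  case (GF4 p q)
  then show ?thesis by (cases p; cases q) simp_all
qed

instantiation gf4 :: field
begin

definition zero_gf4 :: gf4 where "0 = GF4 0 0"

definition one_gf4 :: gf4 where "1 = GF4 1 0"

fun plus_gf4 :: "gf4 \<Rightarrow> gf4 \<Rightarrow> gf4" where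
  "GF4 a b + GF4 c d = GF4 (a + c) (b + d)"

fun uminus_gf4 :: "gf4 \<Rightarrow> gf4" where
  "- GF4 a b = GF4 (- a) (- b)"

definition minus_gf4 :: "gf4 \<Rightarrow> gf4 \<Rightarrow> gf4" where
  "x - y = x + - (y :: gf4)"

fun times_gf4 :: "gf4 \<Rightarrow> gf4 \<Rightarrow> gf4" where
  "GF4 a b * GF4 c d = GF4 (a * c + b * d) (a * d + b * c + b * d)"

definition inverse_gf4 :: "gf4 \<Rightarrow> gf4" where
  "inverse x = x * (x :: gf4)"

definition divide_gf4 :: "gf4 \<Rightarrow> gf4 \<Rightarrow> gf4" where
  "x div y = x * inverse (y :: gf4)"

instance
proof
  fix a b c :: gf4
  note cases = gf4_exhaust[of a] gf4_exhaust[of b] gf4_exhaust[of c]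
  show "a + b + c = a + (b + c)" using cases by (elim disjE) simp_all
  show "a + b = b + a" using cases(1,2) by (elim disjE) simp_all
  show "0 + a = a" using cases(1) by (elim disjE) (simp_all add: zero_gf4_def)
  show "- a + a = 0" using cases(1) by (elim disjE) (simp_all add: zero_gf4_def)
  show "a - b = a + - b" by (simp add: minus_gf4_def)
  show "a * b * c = a * (b * c)" using cases by (elim disjE) simp_all
  show "a * b = b * a" using cases(1,2) by (elim disjE) simp_all
  show "1 * a = a" using cases(1) by (elim disjE) (simp_all add: one_gf4_def)
  show "(a + b) * c = a * c + b * c" using cases by (elim disjE) simp_all
  show "(0 :: gf4) \<noteq> 1" by (simp add: zero_gf4_def one_gf4_def)
  show "inverse a * a = 1" if "a \<noteq> 0"
    using that cases(1)
    by (elim disjE) (simp_all add: zero_gf4_def one_gf4_def inverse_gf4_def)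
  show "a div b = a * inverse b" by (simp add: divide_gf4_def)
  show "inverse (0 :: gf4) = 0" by (simp add: inverse_gf4_def zero_gf4_def)
qed

end

definition \<omega> :: gf4 where "\<omega> = GF4 0 1"

lemma omega_squared: "\<omega>\<^sup>2 = \<omega> + 1"
  by (simp add: \<omega>_def one_gf4_def power2_eq_square)

lemma UNIV_gf4: "(UNIV :: gf4 set) = {0, 1, \<omega>, \<omega>\<^sup>2}"
  using gf4_exhaust by (auto simp: \<omega>_def zero_gf4_def one_gf4_def power2_eq_square)

definition Tr :: "gf4 \<Rightarrow> gf4" where
  "Tr z = z + z\<^sup>2"

text \<open>
  Words of length \<open>n\<close> are lists of length \<open>n\<close>; coordinates are numbered from 0.
\<close>

text \<open>
  \<open>F2_span n vs\<close> is the set of linear combinations, with coefficients in the prime field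
  $\{0,1\} \subseteq \mathbb{F}_4$, of the members of \<open>vs\<close>, which are words of length \<open>n\<close>.
\<close>

definition F2_span :: "nat \<Rightarrow> gf4 list list \<Rightarrow> gf4 list set" where
  "F2_span n vs =
    {map (\<lambda>i. \<Sum>k<length vs. c k * vs ! k ! i) [0..<n] | c :: nat \<Rightarrow> gf4. \<forall>k. c k \<in> {0, 1}}"

definition puncture :: "nat set \<Rightarrow> gf4 list set \<Rightarrow> gf4 list set" where
  "puncture T C = (\<lambda>x. nths x (- T)) ` C"

definition trace_dual :: "nat \<Rightarrow> gf4 list set \<Rightarrow> gf4 list set" where
  "trace_dual n C = {y. length y = n \<and> (\<forall>x\<in>C. (\<Sum>i<n. Tr (x ! i * (y ! i)\<^sup>2)) = 0)}"

definition weight :: "gf4 list \<Rightarrow> nat" where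
  "weight x = card {i. i < length x \<and> x ! i \<noteq> 0}"

text \<open>
  The pairs (weight, number of words of that weight), one for each weight that occurs.
\<close>

definition weight_distribution :: "gf4 list set \<Rightarrow> (nat \<times> nat) set" where
  "weight_distribution C = (\<lambda>w. (w, card {x \<in> C. weight x = w})) ` weight ` C"

definition D_minus :: "gf4 list set" where
  "D_minus = F2_span 11 [
    [0, 0, 0, 0, 0, \<omega>\<^sup>2, \<omega>\<^sup>2, 0, \<omega>, 1, \<omega>],
    [0, 0, 0, 0, 0, \<omega>, 0, \<omega>, \<omega>, \<omega>, 1],
    [1, 0, 0, 0, 0, 1, 0, 1, \<omega>\<^sup>2, \<omega>\<^sup>2, 1],
    [\<omega>, 0, 0, 0, 0, 0, \<omega>, 1, \<omega>, \<omega>, \<omega>],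
    [0, 1, 0, 0, 0, 0, 1, 1, 1, \<omega>\<^sup>2, \<omega>\<^sup>2],
    [0, \<omega>, 0, 0, 0, \<omega>\<^sup>2, 1, \<omega>\<^sup>2, \<omega>, \<omega>, 0],
    [0, 0, 1, 0, 0, \<omega>, \<omega>, 1, 1, 0, 1],
    [0, 0, \<omega>, 0, 0, \<omega>, 1, \<omega>, \<omega>\<^sup>2, \<omega>\<^sup>2, 0],
    [0, 0, 0, 1, 0, \<omega>, \<omega>, \<omega>, 0, 1, \<omega>],
    [0, 0, 0, \<omega>, 0, \<omega>\<^sup>2, 1, 1, \<omega>\<^sup>2, 0, \<omega>],
    [0, 0, 0, 0, 1, \<omega>\<^sup>2, \<omega>\<^sup>2, \<omega>\<^sup>2, 1, 0, \<omega>\<^sup>2],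
    [0, 0, 0, 0, \<omega>, \<omega>, 1, 0, 1, \<omega>, \<omega>]]"

end

theory Submission
  imports Defs
begin

text \<open>
  The trace dual of a punctured code is the shortened dual: it consists of the words of the dual
  of \<open>D_minus\<close> that vanish at the two punctured coordinates, with those coordinates deleted, and
  deletion of zeros preserves weights. The generators of \<open>D_minus\<close> form six pairs in echelon shape,
  the two members of a pair having distinct non-zero leading entries in the same coordinate. Hence a
  dual word is determined by its last five coordinates, which are arbitrary. This lists the 1024 dual
  words explicitly, and the weights are counted for each of the 55 pairs of coordinates.
\<close>

section \<open>The trace form as a parity\<close>

lemma gf4_add_self [simp]: "x + x = (0 :: gf4)"
  by (cases x) (simp add: zero_gf4_def)

text \<open>Since \<open>y^4 = y\<close>, the trace equals \<open>x * y * (x + y)\<close>. For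
  distinct non-zero x and y this is the product of all three non-zero field elements, which is
  1.\<close>

lemma Tr_mult_square: "Tr (x * y\<^sup>2) = of_bool (x \<noteq> 0 \<and> y \<noteq> 0 \<and> x \<noteq> y)"
  using gf4_exhaust[of x] gf4_exhaust[of y]
  by (elim disjE) (simp_all add: Tr_def power2_eq_square zero_gf4_def one_gf4_def)

lemma Tr_0 [simp]: "Tr 0 = 0"
  by (simp add: Tr_def)

lemma Tr_sum: "Tr (\<Sum>i\<in>A. f i) = (\<Sum>i\<in>A. Tr (f i))"
proof -
  have "Tr (x + y) = Tr x + Tr y" for x y
  proof -
    have "Tr (x + y) = Tr x + Tr y + (x * y + x * y)"
      by (simp only: Tr_def power2_eq_square) (simp only: algebra_simps)
    then show ?thesis by simp
  qed
  then show ?thesis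
    by (induction A rule: infinite_finite_induct) simp_all
qed

text \<open>The trace form in executable form: \<open>\<noteq>\<close> on Booleans is addition
  modulo 2.\<close>

fun odd_ip :: "gf4 list \<Rightarrow> gf4 list \<Rightarrow> bool" where
  "odd_ip (x # xs) (y # ys) = ((x \<noteq> 0 \<and> y \<noteq> 0 \<and> x \<noteq> y) \<noteq> odd_ip xs ys)"
| "odd_ip _ _ = False"

lemma trace_form_eq_odd_ip:
  assumes "length x = n" and "length y = n"
  shows "(\<Sum>i<n. Tr (x ! i * (y ! i)\<^sup>2)) = of_bool (odd_ip x y)"
  using assms
proof (induction n arbitrary: x y)
  case 0
  then show ?case by simp
next
  case (Suc n)
  then obtain a x' b y' where "x = a # x'" "y = b # y'" "length x' = n" "length y' = n"
    by (metis length_Suc_conv)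
  with Suc.IH[of x' y'] show ?case
    by (auto simp: sum.lessThan_Suc_shift Tr_mult_square simp del: sum.lessThan_Suc)
qed

section \<open>Duals of spans through generators\<close>

definition annihilator :: "nat \<Rightarrow> gf4 list set \<Rightarrow> gf4 list set" where
  "annihilator n V = {y. length y = n \<and> (\<forall>v\<in>V. \<not> odd_ip v y)}"

lemma trace_dual_eq_annihilator:
  assumes "\<And>x. x \<in> C \<Longrightarrow> length x = n"
  shows "trace_dual n C = annihilator n C"
  using assms by (auto simp: trace_dual_def annihilator_def trace_form_eq_odd_ip)

lemma length_F2_span: "x \<in> F2_span n vs \<Longrightarrow> length x = n"
  by (auto simp: F2_span_def)

text \<open>The form is additive in its first argument, so orthogonality to the generators extends
  to all their sums.\<close>

lemma trace_dual_F2_span: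
  assumes len: "\<And>v. v \<in> set vs \<Longrightarrow> length v = n"
  shows "trace_dual n (F2_span n vs) = annihilator n (set vs)"
proof -
  have "set vs \<subseteq> F2_span n vs"
  proof
    fix v assume "v \<in> set vs"
    then obtain j where j: "j < length vs" "v = vs ! j"
      by (metis in_set_conv_nth)
    have "v = map (\<lambda>i. \<Sum>k<length vs. of_bool (k = j) * vs ! k ! i) [0..<n]"
      using j len[OF \<open>v \<in> set vs\<close>]
      by (intro nth_equalityI) (auto simp: of_bool_def if_distrib[of "\<lambda>c. c * _"] cong: if_cong)
    then show "v \<in> F2_span n vs"
      unfolding F2_span_def by (intro CollectI exI[of _ "\<lambda>k. of_bool (k = j)"]) auto
  qed
  moreover have "(\<Sum>i<n. Tr (x ! i * (y ! i)\<^sup>2)) = 0"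
    if span: "x \<in> F2_span n vs" and y: "y \<in> annihilator n (set vs)" for x y
  proof -
    obtain c where c: "\<forall>k. c k \<in> {0, 1}"
      and x: "x = map (\<lambda>i. \<Sum>k<length vs. c k * vs ! k ! i) [0..<n]"
      using span unfolding F2_span_def by blast
    \<comment> \<open>Coefficients in the prime field pass through the trace; general elements of
      \<open>gf4\<close> do not.\<close>
    have Tr_c: "Tr (c k * z) = c k * Tr z" for k z
      using c[rule_format, of k] by auto
    have "(\<Sum>i<n. Tr (x ! i * (y ! i)\<^sup>2)) =
        (\<Sum>i<n. \<Sum>k<length vs. c k * Tr (vs ! k ! i * (y ! i)\<^sup>2))"
      by (simp add: x sum_distrib_right Tr_sum mult.assoc Tr_c)
    also have "\<dots> = (\<Sum>k<length vs. c k * (\<Sum>i<n. Tr (vs ! k ! i * (y ! i)\<^sup>2)))"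
      by (subst sum.swap) (simp add: sum_distrib_left)
    also have "\<dots> = 0"
    proof (intro sum.neutral ballI)
      fix k assume "k \<in> {..<length vs}"
      then have "vs ! k \<in> set vs" by simp
      then show "c k * (\<Sum>i<n. Tr (vs ! k ! i * (y ! i)\<^sup>2)) = 0"
        using y len by (simp add: annihilator_def trace_form_eq_odd_ip)
    qed
    finally show ?thesis .
  qed
  moreover have "trace_dual n (F2_span n vs) = annihilator n (F2_span n vs)"
    by (rule trace_dual_eq_annihilator) (rule length_F2_span)
  ultimately show ?thesis
    by (auto simp: trace_dual_def annihilator_def)
qed

section \<open>Puncturing a code and shortening its dual\<close>

lemma weight_Nil [simp, code]: "weight [] = 0"
  by (simp add: weight_def)

lemma weight_Cons [simp, code]:
  "weight (x # xs) = (if x = 0 then weight xs else Suc (weight xs))"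
proof -
  have "{i. i < length (x # xs) \<and> (x # xs) ! i \<noteq> 0} =
      (if x = 0 then {} else {0}) \<union> Suc ` {i. i < length xs \<and> xs ! i \<noteq> 0}"
    by (auto simp: image_iff less_Suc_eq_0_disj)
  then show ?thesis
    by (simp add: weight_def card_insert_if card_image)
qed

text \<open>Each deleted position pairs an entry of x with a zero of y and so contributes
  nothing.\<close>

lemma odd_ip_nths:
  assumes "\<And>i. i < length y \<Longrightarrow> i \<notin> A \<Longrightarrow> y ! i = 0"
  shows "odd_ip (nths x A) (nths y A) = odd_ip x y"
  using assms
proof (induction x y arbitrary: A rule: odd_ip.induct)
  case (1 a xs b ys)
  have "odd_ip (nths xs {j. Suc j \<in> A}) (nths ys {j. Suc j \<in> A}) = odd_ip xs ys"
    using "1.prems"[of "Suc _"] by (intro "1.IH") auto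
  moreover have "0 \<in> A \<or> b = 0" using "1.prems"[of 0] by auto
  ultimately show ?case by (auto simp: nths_Cons)
next
  case ("2_2" x)
  then show ?case by (cases x) auto
qed auto

lemma weight_nths:
  assumes "\<And>i. i < length y \<Longrightarrow> i \<notin> A \<Longrightarrow> y ! i = 0"
  shows "weight (nths y A) = weight y"
  using assms
proof (induction y arbitrary: A)
  case (Cons b ys)
  have "weight (nths ys {j. Suc j \<in> A}) = weight ys"
    using Cons.prems[of "Suc _"] by (intro Cons.IH) auto
  moreover have "0 \<in> A \<or> b = 0" using Cons.prems[of 0] by auto
  ultimately show ?case by (auto simp: nths_Cons)
qed simp

text \<open>Existence will make the shortening map surjective, uniqueness will make it
  injective.\<close>

lemma nths_zero_extension:
  assumes "length z = card {i. i < n \<and> i \<in> A}"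
  shows "\<exists>!y. length y = n \<and> (\<forall>i<n. i \<notin> A \<longrightarrow> y ! i = (0 :: gf4)) \<and> nths y A = z"
  using assms
proof (induction n arbitrary: z A)
  case 0
  then show ?case by auto
next
  case (Suc n)
  let ?A = "{j. Suc j \<in> A}"
  have "{i. i < Suc n \<and> i \<in> A} = (if 0 \<in> A then {0} else {}) \<union> Suc ` {i. i < n \<and> i \<in> ?A}"
    by (auto simp: image_iff less_Suc_eq_0_disj)
  then have card: "card {i. i < Suc n \<and> i \<in> A} = of_bool (0 \<in> A) + card {i. i < n \<and> i \<in> ?A}"
    by (simp add: card_insert_if card_image)
  define b where "b = (if 0 \<in> A then hd z else 0)"
  define z' where "z' = (if 0 \<in> A then tl z else z)"
  have "length z' = card {i. i < n \<and> i \<in> ?A}"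
    using Suc.prems card by (auto simp: z'_def)
  from Suc.IH[OF this] obtain y'
    where y': "length y' = n" "\<forall>i<n. i \<notin> ?A \<longrightarrow> y' ! i = 0" "nths y' ?A = z'"
      and uniq: "\<And>y. length y = n \<Longrightarrow> \<forall>i<n. i \<notin> ?A \<longrightarrow> y ! i = 0 \<Longrightarrow> nths y ?A = z' \<Longrightarrow> y = y'"
    by blast
  have z: "0 \<in> A \<Longrightarrow> z = b # z'"
    using Suc.prems card by (cases z) (auto simp: b_def z'_def)
  show ?case
  proof (rule ex1I[of _ "b # y'"])
    show "length (b # y') = Suc n \<and> (\<forall>i<Suc n. i \<notin> A \<longrightarrow> (b # y') ! i = 0) \<and> nths (b # y') A = z"
      using y' z by (auto simp: nths_Cons b_def z'_def nth_Cons split: nat.splits)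
  next
    fix y
    assume y: "length y = Suc n \<and> (\<forall>i<Suc n. i \<notin> A \<longrightarrow> y ! i = 0) \<and> nths y A = z"
    then obtain c ys where ys: "y = c # ys" "length ys = n"
      by (auto simp: length_Suc_conv)
    have 0: "0 \<notin> A \<longrightarrow> c = 0" and S: "\<forall>i<n. i \<notin> ?A \<longrightarrow> ys ! i = 0"
      using y ys by (auto simp: All_less_Suc2)
    have "(if 0 \<in> A then [c] else []) @ nths ys ?A = z"
      using y ys by (simp add: nths_Cons)
    then have "nths ys ?A = z'" "c = b"
      using 0 by (auto simp: b_def z'_def split: if_splits)
    with uniq[OF ys(2) S] ys show "y = b # y'" by simp
  qed
qed

text \<open>A word and its extension by zeros have the same products with a punctured codeword and
  with the original codeword, respectively.\<close>

lemma annihilator_puncture: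
  fixes T :: "nat set"
  assumes C: "\<And>x. x \<in> C \<Longrightarrow> length x = n" and m: "m = card {i. i < n \<and> i \<in> - T}"
  defines "S \<equiv> {y \<in> annihilator n C. \<forall>i<n. i \<in> T \<longrightarrow> y ! i = 0}"
  shows "annihilator m (puncture T C) = (\<lambda>y. nths y (- T)) ` S"
    and "inj_on (\<lambda>y. nths y (- T)) S"
proof -
  have len: "length (nths y (- T)) = m" if "length y = n" for y :: "gf4 list"
    using that m by (simp add: length_nths)
  show "inj_on (\<lambda>y. nths y (- T)) S"
  proof (rule inj_onI)
    fix y y' assume "y \<in> S" "y' \<in> S" "nths y (- T) = nths y' (- T)"
    then show "y = y'"
      using nths_zero_extension[of "nths y (- T)" n "- T"] len[of y] m
      by (auto simp: S_def annihilator_def)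
  qed
  show "annihilator m (puncture T C) = (\<lambda>y. nths y (- T)) ` S"
  proof (intro equalityI subsetI)
    fix z assume z: "z \<in> annihilator m (puncture T C)"
    then obtain y where y: "length y = n" "\<forall>i<n. i \<notin> - T \<longrightarrow> y ! i = 0" "nths y (- T) = z"
      using nths_zero_extension[of z n "- T"] m by (auto simp: annihilator_def)
    have "\<not> odd_ip x y" if "x \<in> C" for x
      using z that y odd_ip_nths[of y "- T" x] by (auto simp: annihilator_def puncture_def)
    with y show "z \<in> (\<lambda>y. nths y (- T)) ` S"
      by (auto simp: S_def annihilator_def)
  next
    fix z assume "z \<in> (\<lambda>y. nths y (- T)) ` S"
    then obtain y where y: "y \<in> S" "z = nths y (- T)" by auto
    then have "odd_ip (nths x (- T)) z = odd_ip x y" for x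
      by (auto simp: S_def annihilator_def intro!: odd_ip_nths)
    with y len[of y] show "z \<in> annihilator m (puncture T C)"
      by (auto simp: S_def annihilator_def puncture_def)
  qed
qed

lemma weight_distribution_image:
  assumes inj: "inj_on f A" and w: "\<And>x. x \<in> A \<Longrightarrow> weight (f x) = weight x"
  shows "weight_distribution (f ` A) = weight_distribution A"
proof -
  have "{x \<in> f ` A. weight x = k} = f ` {x \<in> A. weight x = k}" for k
    using w by auto
  moreover have "card (f ` {x \<in> A. weight x = k}) = card {x \<in> A. weight x = k}" for k
    by (intro card_image inj_on_subset[OF inj]) auto
  moreover have "weight ` f ` A = weight ` A"
    using w by (force simp: image_iff)
  ultimately show ?thesis
    by (simp add: weight_distribution_def)
qed

section \<open>Solving the parity checks in echelon form\<close>

text \<open>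
  On $\mathbb{F}_4$ the trace form is alternating and takes the value 1 on distinct non-zero \<open>p\<close>, \<open>q\<close>,
  so the unique \<open>a\<close> with prescribed products $A$ with \<open>p\<close> and $B$ with \<open>q\<close> is $B p + A q$.
\<close>

definition extend :: "gf4 list \<times> gf4 list \<Rightarrow> gf4 list \<Rightarrow> gf4 list" where
  "extend = (\<lambda>(v, w) y.
    ((if odd_ip (tl w) y then hd v else 0) + (if odd_ip (tl v) y then hd w else 0)) # y)"

text \<open>The rows from V constrain only the tail y. Given y, the two new rows prescribe the
  products of the first letter with p and q, which determines that letter.\<close>

lemma annihilator_Cons_Cons:
  assumes "p \<noteq> 0" "q \<noteq> 0" "p \<noteq> q"
  shows "annihilator (Suc n) ({p # r, q # s} \<union> (#) 0 ` V) = extend (p # r, q # s) ` annihilator n V"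
proof -
  have lead: "((p \<noteq> 0 \<and> a \<noteq> 0 \<and> p \<noteq> a) = A \<and> (q \<noteq> 0 \<and> a \<noteq> 0 \<and> q \<noteq> a) = B) \<longleftrightarrow>
      a = (if B then p else 0) + (if A then q else 0)" for a A B
    using assms gf4_exhaust[of p] gf4_exhaust[of q] gf4_exhaust[of a]
    by (elim disjE; cases A; cases B; simp add: zero_gf4_def)
  have "a # y \<in> annihilator (Suc n) ({p # r, q # s} \<union> (#) 0 ` V) \<longleftrightarrow>
      y \<in> annihilator n V \<and> a # y = extend (p # r, q # s) y" for a y
    using lead[of a "odd_ip r y" "odd_ip s y"] by (auto simp: annihilator_def extend_def)
  moreover have "a # y = extend vw y' \<longrightarrow> y' = y" for a y y' vw
    by (simp add: extend_def split: prod.splits)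
  ultimately have "a # y \<in> annihilator (Suc n) ({p # r, q # s} \<union> (#) 0 ` V) \<longleftrightarrow>
      a # y \<in> extend (p # r, q # s) ` annihilator n V" for a y
    by blast
  moreover have "[] \<notin> annihilator (Suc n) ({p # r, q # s} \<union> (#) 0 ` V)"
    and "[] \<notin> extend (p # r, q # s) ` annihilator n V"
    by (auto simp: annihilator_def extend_def)
  ultimately show ?thesis
    by (intro set_eqI) (metis neq_Nil_conv)
qed

lemma inj_extend: "inj (extend vw)"
  by (auto simp: inj_def extend_def split: prod.splits)

text \<open>Each pair of rows solves for one further letter on the left; the fold over row sets
  restores the leading zeros.\<close>

lemma annihilator_foldr:
  assumes "\<And>v w. (v, w) \<in> set ps \<Longrightarrow>
    v \<noteq> [] \<and> w \<noteq> [] \<and> hd v \<noteq> 0 \<and> hd w \<noteq> 0 \<and> hd v \<noteq> hd w"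
  shows "annihilator (length ps + n) (foldr (\<lambda>(v, w) V. {v, w} \<union> (#) 0 ` V) ps V) =
    foldr (\<lambda>vw. (`) (extend vw)) ps (annihilator n V)"
  using assms
proof (induction ps)
  case (Cons vw ps)
  obtain p r q s where vw: "vw = (p # r, q # s)" and "p \<noteq> 0" "q \<noteq> 0" "p \<noteq> q"
    using Cons.prems by (cases vw) (force simp: neq_Nil_conv)
  moreover have "annihilator (length ps + n) (foldr (\<lambda>(v, w) V. {v, w} \<union> (#) 0 ` V) ps V) =
      foldr (\<lambda>vw. (`) (extend vw)) ps (annihilator n V)"
    using Cons.prems by (intro Cons.IH) auto
  ultimately show ?case
    using annihilator_Cons_Cons[of p q] by simp
qed simp

text \<open>The generators of \<open>D_minus\<close> in pairs, without the zeros before the pivot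
  coordinate. The first two generators have their pivot in the sixth coordinate and therefore come
  last.\<close>

definition check_rows :: "(gf4 list \<times> gf4 list) list" where
  "check_rows = [
    ([1, 0, 0, 0, 0, 1, 0, 1, \<omega>\<^sup>2, \<omega>\<^sup>2, 1],
     [\<omega>, 0, 0, 0, 0, 0, \<omega>, 1, \<omega>, \<omega>, \<omega>]),
    ([1, 0, 0, 0, 0, 1, 1, 1, \<omega>\<^sup>2, \<omega>\<^sup>2],
     [\<omega>, 0, 0, 0, \<omega>\<^sup>2, 1, \<omega>\<^sup>2, \<omega>, \<omega>, 0]),
    ([1, 0, 0, \<omega>, \<omega>, 1, 1, 0, 1],
     [\<omega>, 0, 0, \<omega>, 1, \<omega>, \<omega>\<^sup>2, \<omega>\<^sup>2, 0]),
    ([1, 0, \<omega>, \<omega>, \<omega>, 0, 1, \<omega>],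
     [\<omega>, 0, \<omega>\<^sup>2, 1, 1, \<omega>\<^sup>2, 0, \<omega>]),
    ([1, \<omega>\<^sup>2, \<omega>\<^sup>2, \<omega>\<^sup>2, 1, 0, \<omega>\<^sup>2],
     [\<omega>, \<omega>, 1, 0, 1, \<omega>, \<omega>]),
    ([\<omega>\<^sup>2, \<omega>\<^sup>2, 0, \<omega>, 1, \<omega>],
     [\<omega>, 0, \<omega>, \<omega>, \<omega>, 1])]"

definition dual_words :: "gf4 list list" where
  "dual_words = foldr (\<lambda>vw. map (extend vw)) check_rows (List.n_lists 5 [0, 1, \<omega>, \<omega>\<^sup>2])"

lemma distinct_dual_words: "distinct dual_words"
proof -
  have "distinct (foldr (\<lambda>vw. map (extend vw)) ps ys)" if "distinct ys" for ps ys
    using that inj_extend by (induction ps) (auto simp: distinct_map intro: inj_on_subset)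
  moreover have "distinct [0, 1, \<omega>, \<omega>\<^sup>2]"
    by (simp add: \<omega>_def zero_gf4_def one_gf4_def power2_eq_square)
  ultimately show ?thesis
    unfolding dual_words_def by (simp add: distinct_n_lists)
qed

lemma trace_dual_D_minus: "trace_dual 11 D_minus = set dual_words"
proof -
  have nz: "(1 :: gf4) \<noteq> \<omega>" "\<omega> \<noteq> 0" "\<omega>\<^sup>2 \<noteq> 0" "\<omega>\<^sup>2 \<noteq> \<omega>"
    by (simp_all add: \<omega>_def zero_gf4_def one_gf4_def power2_eq_square)
  let ?rows = "foldr (\<lambda>(v, w) V. {v, w} \<union> (#) 0 ` V) check_rows {}"
  have "trace_dual 11 D_minus = annihilator (length check_rows + 5) ?rows"
    unfolding D_minus_def
    by (subst trace_dual_F2_span) (auto simp: check_rows_def intro!: arg_cong[of _ _ "annihilator 11"])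
  also have "\<dots> = foldr (\<lambda>vw. (`) (extend vw)) check_rows (annihilator 5 {})"
    by (rule annihilator_foldr) (auto simp: check_rows_def nz)
  \<comment> \<open>Without checks all words of length 5 remain: these are the free last
    coordinates.\<close>
  also have "annihilator 5 {} = set (List.n_lists 5 [0, 1, \<omega>, \<omega>\<^sup>2])"
    using UNIV_gf4 by (auto simp: annihilator_def set_n_lists)
  also have "foldr (\<lambda>vw. (`) (extend vw)) ps (set ys) = set (foldr (\<lambda>vw. map (extend vw)) ps ys)"
    for ps ys
    by (induction ps) auto
  finally show ?thesis
    by (simp add: dual_words_def)
qed

section \<open>Counting weights by evaluation\<close>

definition dist_6_8 :: "nat list \<Rightarrow> bool" where
  "dist_6_8 ws \<longleftrightarrow> list_all (\<lambda>w. w = 0 \<or> w = 6 \<or> w = 8) ws \<and>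
    length (filter ((=) 0) ws) = 1 \<and> length (filter ((=) 6) ws) = 36 \<and> length (filter ((=) 8) ws) = 27"

lemma weight_distribution_dist_6_8:
  assumes "distinct ys" and ok: "dist_6_8 (map weight ys)"
  shows "weight_distribution (set ys) = {(0, 1), (6, 36), (8, 27)}"
proof -
  have card: "card {x \<in> set ys. weight x = w} = length (filter ((=) w) (map weight ys))" for w
    using assms(1) by (simp add: filter_map comp_def eq_commute distinct_card[symmetric])
  have "weight ` set ys \<subseteq> {0, 6, 8}"
    using ok by (auto simp: dist_6_8_def list_all_iff)
  \<comment> \<open>All three prescribed counts are non-zero, so each weight occurs.\<close>
  moreover have "w \<in> weight ` set ys" if "w \<in> {0, 6, 8}" for w
  proof -
    have "card {x \<in> set ys. weight x = w} \<noteq> 0"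
      using that ok unfolding card dist_6_8_def by auto
    then show ?thesis
      by (auto simp: card_eq_0_iff)
  qed
  ultimately have "weight ` set ys = {0, 6, 8}"
    by blast
  then show ?thesis
    using ok unfolding weight_distribution_def card by (simp add: dist_6_8_def)
qed

text \<open>
  The simplifier normalises the branches of an \<open>if\<close> only after the condition has been decided
  and then traverses them anew, so the library equation for \<^const>\<open>filter\<close> takes quadratic time
  under \<open>code_simp\<close>.
\<close>

fun cons_when :: "bool \<Rightarrow> 'a \<Rightarrow> 'a list \<Rightarrow> 'a list" where
  "cons_when True x xs = x # xs"
| "cons_when False x xs = xs"

lemma filter_cons_when [code]:
  "filter P [] = []"
  "filter P (x # xs) = cons_when (P x) x (filter P xs)"
  by simp_all

text \<open>
  Words are encoded by their weight and their zero pattern. The recursions are spelled out because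
  \<open>code_simp\<close> would unfold the body of a \<open>list_all\<close> predicate symbolically, for an unknown coordinate.
\<close>

fun shortenings_ok :: "nat list \<Rightarrow> (nat \<times> bool list) list \<Rightarrow> bool" where
  "shortenings_ok [] ps = True"
| "shortenings_ok (j # js) ps \<longleftrightarrow>
    dist_6_8 (map fst (filter (\<lambda>p. snd p ! j) ps)) \<and> shortenings_ok js ps"

fun pair_shortenings_ok :: "nat list \<Rightarrow> (nat \<times> bool list) list \<Rightarrow> bool" where
  "pair_shortenings_ok [] ps = True"
| "pair_shortenings_ok (i # is) ps \<longleftrightarrow>
    shortenings_ok is (filter (\<lambda>p. snd p ! i) ps) \<and> pair_shortenings_ok is ps"

lemma shortenings_okD:
  "shortenings_ok js ps \<Longrightarrow> j \<in> set js \<Longrightarrow> dist_6_8 (map fst (filter (\<lambda>p. snd p ! j) ps))"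
  by (induction js) auto

text \<open>The recursion pairs each index only with later ones in the list, hence the sortedness
  and \<open>i < j\<close>.\<close>

lemma pair_shortenings_okD:
  "pair_shortenings_ok is ps \<Longrightarrow> sorted_wrt (<) is \<Longrightarrow> i \<in> set is \<Longrightarrow> j \<in> set is \<Longrightarrow> i < j \<Longrightarrow>
    dist_6_8 (map fst (filter (\<lambda>p. snd p ! j) (filter (\<lambda>p. snd p ! i) ps)))"
  by (induction "is") (auto dest: shortenings_okD simp del: filter_filter)

text \<open>Evaluation over the 1024 dual words; each of the 55 pairs of coordinates leaves 1 + 36 +
  27 = 64 of them.\<close>

lemma dual_words_shortenings:
  "pair_shortenings_ok [0..<11] (map (\<lambda>y. (weight y, map ((=) 0) y)) dual_words)"
  by code_simp

lemma dist_6_8_dual_words: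
  assumes "i < j" and "j < 11"
  shows "dist_6_8 (map weight (filter (\<lambda>y. y ! j = 0) (filter (\<lambda>y. y ! i = 0) dual_words)))"
proof -
  let ?f = "\<lambda>y. (weight y, map ((=) 0) y)"
  have len: "length y = 11" if "y \<in> set dual_words" for y
    using that by (simp add: trace_dual_D_minus[symmetric] trace_dual_def)
  have "map fst (filter (\<lambda>p. snd p ! j) (filter (\<lambda>p. snd p ! i) (map ?f dual_words))) =
      map weight (filter (\<lambda>y. map ((=) 0) y ! i \<and> map ((=) 0) y ! j) dual_words)"
    by (simp add: filter_map comp_def)
  also have "filter (\<lambda>y. map ((=) 0) y ! i \<and> map ((=) 0) y ! j) dual_words =
      filter (\<lambda>y. y ! j = 0) (filter (\<lambda>y. y ! i = 0) dual_words)"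
    using assms by (auto simp: len intro!: filter_cong)
  finally show ?thesis
    using pair_shortenings_okD[OF dual_words_shortenings, of i j] assms
    by (simp only:) simp
qed

theorem theorem5:
  fixes T :: "nat set"
  assumes "T \<subseteq> {..<11}" and "card T = 2"
  shows "weight_distribution (trace_dual 9 (puncture T D_minus)) = {(0, 1), (6, 36), (8, 27)}"
proof -
  obtain i j where ij: "T = {i, j}" "i < j" "j < 11"
  proof -
    obtain a b where "T = {a, b}" "a \<noteq> b"
      using assms(2) by (auto simp: card_2_iff)
    with assms(1) that[of a b] that[of b a] show thesis
      by (cases "a < b") (auto simp: insert_commute)
  qed
  have len: "length x = 11" if "x \<in> D_minus" for x
    using that unfolding D_minus_def by (rule length_F2_span)
  have "{i. i < 11 \<and> i \<in> - T} = {..<11} - T"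
    by auto
  then have 9: "9 = card {i. i < 11 \<and> i \<in> - T}"
    using assms by (simp add: card_Diff_subset finite_subset)
  have "length x = 9" if "x \<in> puncture T D_minus" for x
    using that len 9 by (auto simp: puncture_def length_nths)
  then have "trace_dual 9 (puncture T D_minus) = annihilator 9 (puncture T D_minus)"
    by (rule trace_dual_eq_annihilator)
  also have "\<dots> =
      (\<lambda>y. nths y (- T)) ` {y \<in> annihilator 11 D_minus. \<forall>i<11. i \<in> T \<longrightarrow> y ! i = 0}"
    by (rule annihilator_puncture[OF len 9])
  also have "weight_distribution \<dots> =
      weight_distribution {y \<in> annihilator 11 D_minus. \<forall>i<11. i \<in> T \<longrightarrow> y ! i = 0}"
    by (intro weight_distribution_image annihilator_puncture[OF len 9] weight_nths)
      (auto simp: annihilator_def)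
  \<comment> \<open>The shortened dual becomes a duplicate-free list, to which the evaluated counts
    apply.\<close>
  also have "{y \<in> annihilator 11 D_minus. \<forall>i<11. i \<in> T \<longrightarrow> y ! i = 0} =
      set (filter (\<lambda>y. y ! j = 0) (filter (\<lambda>y. y ! i = 0) dual_words))"
  proof -
    have "(\<forall>k<11. k \<in> T \<longrightarrow> y ! k = 0) \<longleftrightarrow> y ! i = 0 \<and> y ! j = 0" for y :: "gf4 list"
      using ij by (metis insert_iff less_trans singletonD)
    then show ?thesis
      by (auto simp: trace_dual_D_minus[symmetric] trace_dual_eq_annihilator[OF len])
  qed
  also have "weight_distribution \<dots> = {(0, 1), (6, 36), (8, 27)}"
    using ij distinct_dual_words
    by (intro weight_distribution_dist_6_8 dist_6_8_dual_words) auto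
  finally show ?thesis .
qed

end
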